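(* Let $\gamma>1$ and $K\in\mathbb{R}$, and consider the two-sided sonic configuration $(\Omega^\pm,\varphi^\pm,\Gamma_{\rm sonic})$ described in the context, with $\Gamma_{\rm sonic}$ connected. If all sonic points are exceptional and $c>0$ on $\Gamma_{\rm sonic}$, then $c\equiv c_2$ on $\Gamma_{\rm sonic}$ for some constant $c_2$, $\Gamma_{\rm sonic}$ lies on a circle, and there are constants $(u_2,v_2)$ such that $(U,V)=(u_2-\xi,\,v_2-\eta)$ on $\Gamma_{\rm sonic}$.
   Context: Equation. Fix $\gamma>1$ and $K\in\mathbb{R}$. In coordinates $(\xi,\eta)\in\mathbb{R}^2$, with $D=(\partial_\xi,\partial_\eta)$, self-similar potential flow is $\mathrm{div}(\rho D\varphi)+2\rho=0$ with $\rho=(K-\varphi-\frac12|D\varphi|^2)^{1/(\gamma-1)}$. The sonic speed $c\ge 0$ is given by $c^2=(\gamma-1)(K-\varphi-\frac12|D\varphi|^2)$. The pseudo-velocity is $(U,V)=D\varphi$ and the velocity is $(u,v)=(U,V)+(\xi,\eta)$. Equivalently, $(c^2-U^2)u_\xi-UV(u_\eta+v_\xi)+(c^2-V^2)v_\eta=0$, $u_\eta=v_\xi$, and $\frac{c^2}{\gamma-1}+\frac{U^2+V^2}{2}+\varphi=K$. The solution is (pseudo-)supersonic where $|D\varphi|>c$, (pseudo-)subsonic where $|D\varphi|<c$, and a point is (pseudo-)sonic if $|D\varphi|=c$. Configuration. $\Omega^-$ and $\Omega^+$ are the supersonic and subsonic regions, lying on the two sides of the curve formed by all sonic points; $\Gamma_{\rm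 sonic}$ denotes the relative interior of that curve. $\varphi^-\in C^2(\overline{\Omega^-})$ is a supersonic solution in $\Omega^-$, $\varphi^+\in C^2(\Omega^+\cup\Gamma_{\rm sonic})$ is a subsonic solution in $\Omega^+$, and $\varphi^+=\varphi^-$, $D\varphi^+=D\varphi^-$ on $\Gamma_{\rm sonic}$. Write $\varphi=\varphi^\pm$ on the respective sides. For each $Q\in\Gamma_{\rm sonic}$, in suitable (rotated) coordinates $(\xi,\eta)$ (the equations are invariant under rotation) there is $r>0$ such that $\Gamma_{\rm sonic}\cap B_r(Q)=\{\eta=f(\xi)\}\cap B_r(Q)$ with $f\in C^{1,1}((l_1,l_2))$, $l_1<l_2$. A point $(\xi,f(\xi))\in\Gamma_{\rm sonic}$ is called exceptional if $(U,V)(\xi,f(\xi))$ is normal to $\Gamma_{\rm sonic}$ there, i.e. $U+f'(\xi)V=0$. *)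

theory Defs
  imports "HOL-Analysis.Analysis"
begin

type_synonym plane = "real \<times> real"

text \<open>
  A potential is given by a pair \<open>\<phi>\<close>, \<open>G\<close>, where \<open>G = (U, V)\<close> is the gradient of \<open>\<phi>\<close>.
  The predicate below says that \<open>\<phi>\<close> is of class \<open>C\<^sup>2\<close> on \<open>E\<close>, where \<open>\<Omega> \<subseteq> E \<subseteq> closure \<Omega>\<close>: it is
  of class \<open>C\<^sup>2\<close> in the open set \<open>\<Omega>\<close>, and the derivatives of order at most two extend continuously
  to \<open>E\<close>. Since \<open>\<Omega>\<close> is dense in \<open>E\<close>, the values of \<open>G\<close> on all of \<open>E\<close> are determined by \<open>\<phi>\<close>.
\<close>

definition C2_upto :: "plane set \<Rightarrow> plane set \<Rightarrow> (plane \<Rightarrow> real) \<Rightarrow> (plane \<Rightarrow> plane) \<Rightarrow> bool" where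
  "C2_upto \<Omega> E \<phi> G \<longleftrightarrow>
     open \<Omega> \<and> \<Omega> \<subseteq> E \<and> E \<subseteq> closure \<Omega> \<and>
     (\<exists>H :: plane \<Rightarrow> (plane \<Rightarrow>\<^sub>L plane).
        continuous_on E \<phi> \<and> continuous_on E G \<and> continuous_on E H \<and>
        (\<forall>x\<in>\<Omega>. (\<phi> has_derivative (\<lambda>h. G x \<bullet> h)) (at x) \<and>
               (G has_derivative blinfun_apply (H x)) (at x)))"

definition bernoulli :: "real \<Rightarrow> (plane \<Rightarrow> real) \<Rightarrow> (plane \<Rightarrow> plane) \<Rightarrow> plane \<Rightarrow> real" where
  "bernoulli K \<phi> G x = K - \<phi> x - (norm (G x))\<^sup>2 / 2"

definition density :: "real \<Rightarrow> real \<Rightarrow> (plane \<Rightarrow> real) \<Rightarrow> (plane \<Rightarrow> plane) \<Rightarrow> plane \<Rightarrow> real" where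
  "density \<gamma> K \<phi> G x = bernoulli K \<phi> G x powr (1 / (\<gamma> - 1))"

text \<open>Only meaningful where \<^const>\<open>bernoulli\<close> is nonnegative, which solutions are required to satisfy.\<close>

definition sonic_speed :: "real \<Rightarrow> real \<Rightarrow> (plane \<Rightarrow> real) \<Rightarrow> (plane \<Rightarrow> plane) \<Rightarrow> plane \<Rightarrow> real" where
  "sonic_speed \<gamma> K \<phi> G x = sqrt ((\<gamma> - 1) * bernoulli K \<phi> G x)"

text \<open>Classical solutions of \<open>div (\<rho> D\<phi>) + 2\<rho> = 0\<close> in \<open>\<Omega>\<close>.\<close>

definition potential_flow ::
  "real \<Rightarrow> real \<Rightarrow> plane set \<Rightarrow> (plane \<Rightarrow> real) \<Rightarrow> (plane \<Rightarrow> plane) \<Rightarrow> bool" where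
  "potential_flow \<gamma> K \<Omega> \<phi> G \<longleftrightarrow>
     (\<forall>(\<xi>, \<eta>)\<in>\<Omega>.
        0 \<le> bernoulli K \<phi> G (\<xi>, \<eta>) \<and>
        (\<exists>a b.
           ((\<lambda>s. density \<gamma> K \<phi> G (s, \<eta>) * fst (G (s, \<eta>))) has_real_derivative a) (at \<xi>) \<and>
           ((\<lambda>t. density \<gamma> K \<phi> G (\<xi>, t) * snd (G (\<xi>, t))) has_real_derivative b) (at \<eta>) \<and>
           a + b + 2 * density \<gamma> K \<phi> G (\<xi>, \<eta>) = 0))"

definition supersonic_at :: "real \<Rightarrow> real \<Rightarrow> (plane \<Rightarrow> real) \<Rightarrow> (plane \<Rightarrow> plane) \<Rightarrow> plane \<Rightarrow> bool" where
  "supersonic_at \<gamma> K \<phi> G x \<longleftrightarrow> norm (G x) > sonic_speed \<gamma> K \<phi> G x"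

definition subsonic_at :: "real \<Rightarrow> real \<Rightarrow> (plane \<Rightarrow> real) \<Rightarrow> (plane \<Rightarrow> plane) \<Rightarrow> plane \<Rightarrow> bool" where
  "subsonic_at \<gamma> K \<phi> G x \<longleftrightarrow> norm (G x) < sonic_speed \<gamma> K \<phi> G x"

definition sonic_at :: "real \<Rightarrow> real \<Rightarrow> (plane \<Rightarrow> real) \<Rightarrow> (plane \<Rightarrow> plane) \<Rightarrow> plane \<Rightarrow> bool" where
  "sonic_at \<gamma> K \<phi> G x \<longleftrightarrow> norm (G x) = sonic_speed \<gamma> K \<phi> G x"

text \<open>
  A curve is a one-dimensional topological manifold, possibly with boundary points (its end points);
  its relative interior is the interior in the sense of manifolds.
\<close>

definition is_curve :: "plane set \<Rightarrow> bool" where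
  "is_curve S \<longleftrightarrow>
     (\<forall>x\<in>S. \<exists>W. openin (top_of_set S) W \<and> x \<in> W \<and>
        (W homeomorphic {0<..<1::real} \<or> W homeomorphic {0..<1::real}))"

definition curve_interior :: "plane set \<Rightarrow> plane set" where
  "curve_interior S =
     {x \<in> S. \<exists>W. openin (top_of_set S) W \<and> x \<in> W \<and> W homeomorphic {0<..<1::real}}"

text \<open>
  Coordinates with respect to axes rotated by the angle \<open>\<theta>\<close>. The gradient of \<open>\<phi>\<close> in the rotated
  coordinates is obtained by applying the same map to \<open>G\<close>.
\<close>

definition rot :: "real \<Rightarrow> plane \<Rightarrow> plane" where
  "rot \<theta> x = (cos \<theta> * fst x + sin \<theta> * snd x, - sin \<theta> * fst x + cos \<theta> * snd x)"

definition C11_on :: "real \<Rightarrow> real \<Rightarrow> (real \<Rightarrow> real) \<Rightarrow> bool" where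
  "C11_on l1 l2 f \<longleftrightarrow>
     f differentiable_on {l1<..<l2} \<and> (\<exists>C. C-lipschitz_on {l1<..<l2} (deriv f))"

text \<open>
  Near \<open>Q\<close>, in coordinates rotated by \<open>\<theta>\<close>, \<open>\<Gamma>\<close> is the graph of the \<open>C\<^sup>1\<^sup>,\<^sup>1\<close> function \<open>f\<close>. As \<open>(l1, l2)\<close>
  is open, asking that it contains the first coordinates of the whole ball only means taking \<open>r\<close>
  small.
\<close>

definition graph_at ::
  "plane set \<Rightarrow> plane \<Rightarrow> real \<Rightarrow> real \<Rightarrow> real \<Rightarrow> real \<Rightarrow> (real \<Rightarrow> real) \<Rightarrow> bool" where
  "graph_at \<Gamma> Q \<theta> r l1 l2 f \<longleftrightarrow>
     0 < r \<and> l1 < l2 \<and> C11_on l1 l2 f \<and>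
     (\<forall>x\<in>ball Q r. fst (rot \<theta> x) \<in> {l1<..<l2}) \<and>
     \<Gamma> \<inter> ball Q r = {x. snd (rot \<theta> x) = f (fst (rot \<theta> x))} \<inter> ball Q r"

definition exceptional :: "plane set \<Rightarrow> (plane \<Rightarrow> plane) \<Rightarrow> plane \<Rightarrow> bool" where
  "exceptional \<Gamma> G Q \<longleftrightarrow>
     Q \<in> \<Gamma> \<and>
     (\<exists>\<theta> r l1 l2 f. graph_at \<Gamma> Q \<theta> r l1 l2 f \<and>
        fst (rot \<theta> (G Q)) + deriv f (fst (rot \<theta> Q)) * snd (rot \<theta> (G Q)) = 0)"

text \<open>
  \<open>D\<close> is the region in which the flow is considered; points of \<open>D\<close> on the boundary of \<open>\<Omega>\<^sup>-\<close> are
  allowed, since \<open>\<phi>\<^sup>-\<close> is \<open>C\<^sup>2\<close> up to the boundary. There are no sonic points in \<open>\<Omega>\<^sup>+\<close>, so \<open>sonic_set\<close>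
  consists of all sonic points of \<open>D\<close>. In the assumption \<open>two_sided\<close>, the choice of the side on which
  \<open>\<Omega>\<^sup>-\<close> lies is no restriction, because \<open>\<theta>\<close> can be replaced by \<open>\<theta> + \<pi>\<close>.
\<close>

locale sonic_configuration =
  fixes \<gamma> K :: real
    and D \<Omega>m \<Omega>p :: "plane set"
    and \<phi>m :: "plane \<Rightarrow> real" and Gm :: "plane \<Rightarrow> plane"
    and \<phi>p :: "plane \<Rightarrow> real" and Gp :: "plane \<Rightarrow> plane"
    and \<Gamma> :: "plane set"
  fixes sonic_set :: "plane set"
  defines "sonic_set \<equiv> {x \<in> D - \<Omega>p. sonic_at \<gamma> K \<phi>m Gm x}"
  assumes disjoint: "\<Omega>m \<inter> \<Omega>p = {}"
    and flow_region: "\<Omega>m \<union> \<Omega>p \<subseteq> D" "D \<subseteq> closure \<Omega>m \<union> \<Omega>p"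
    and C2_m: "C2_upto \<Omega>m (closure \<Omega>m) \<phi>m Gm"
    and C2_p: "C2_upto \<Omega>p (\<Omega>p \<union> \<Gamma>) \<phi>p Gp"
    and solution_m: "potential_flow \<gamma> K \<Omega>m \<phi>m Gm"
    and solution_p: "potential_flow \<gamma> K \<Omega>p \<phi>p Gp"
    and supersonic: "\<forall>x\<in>\<Omega>m. supersonic_at \<gamma> K \<phi>m Gm x"
    and subsonic: "\<forall>x\<in>\<Omega>p. subsonic_at \<gamma> K \<phi>p Gp x"
    and curve: "is_curve sonic_set"
    and Gamma: "\<Gamma> = curve_interior sonic_set"
    and matching: "\<forall>x\<in>\<Gamma>. \<phi>p x = \<phi>m x \<and> Gp x = Gm x"
    and two_sided: "\<forall>Q\<in>\<Gamma>. \<exists>\<theta> r l1 l2 f. graph_at \<Gamma> Q \<theta> r l1 l2 f \<and>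
          \<Omega>m \<inter> ball Q r = {x. snd (rot \<theta> x) < f (fst (rot \<theta> x))} \<inter> ball Q r \<and>
          \<Omega>p \<inter> ball Q r = {x. snd (rot \<theta> x) > f (fst (rot \<theta> x))} \<inter> ball Q r"

end

theory Submission
  imports Defs
begin

text \<open>
  Write \<open>\<phi>\<close> for \<open>\<phi>\<^sup>-\<close>. Exceptionality means \<open>D\<phi> \<bullet> T = 0\<close> for the tangent \<open>T\<close> of \<open>\<Gamma>\<close>, so \<open>\<phi>\<close> is
  constant along \<open>\<Gamma>\<close>. The Bernoulli law with \<open>|D\<phi>| = c\<close> then makes \<open>c\<close> constant, and differentiating
  \<open>|D\<phi>|\<^sup>2\<close> along \<open>\<Gamma>\<close> gives \<open>D\<phi> \<bullet> (D\<^sup>2\<phi> T) = 0\<close>. At a sonic point the equation itself reduces to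
  \<open>T \<bullet> (D\<^sup>2\<phi> T + T) = 0\<close>. As \<open>D\<phi>\<close> is normal to \<open>\<Gamma>\<close>, both components of \<open>D\<^sup>2\<phi> T + T\<close>, the tangential
  derivative of \<open>(u, v) = D\<phi> + (\<xi>, \<eta>)\<close>, vanish. So \<open>(u, v)\<close> is constant on \<open>\<Gamma>\<close>, and \<open>\<Gamma>\<close> lies on the
  circle of radius \<open>c\<close> about this constant.
\<close>

section \<open>Differentiation along boundary arcs\<close>

text \<open>The arc may run along the boundary of \<open>\<Omega>\<close>. Because \<open>n\<close>
  is one fixed vector, the pushed arcs inside \<open>\<Omega>\<close> have the same velocity
  \<open>x'\<close>; because \<open>d\<close> does not depend on \<open>s\<close>, whole arcs can be
  pushed in at once.\<close>

definition accessible_arc ::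
  "'a::real_normed_vector set \<Rightarrow> real \<Rightarrow> real \<Rightarrow> 'a \<Rightarrow> (real \<Rightarrow> 'a) \<Rightarrow> (real \<Rightarrow> 'a) \<Rightarrow> bool" where
  "accessible_arc \<Omega> t d n x x' \<longleftrightarrow>
     0 < d \<and> continuous_on (ball t d) x' \<and>
     (\<forall>s\<in>ball t d. (x has_vector_derivative x' s) (at s) \<and>
        (\<forall>e. 0 < e \<and> e < d \<longrightarrow> x s + e *\<^sub>R n \<in> \<Omega>))"

lemma accessible_arc_vector_derivative:
  "accessible_arc \<Omega> t d n x x' \<Longrightarrow> s \<in> ball t d \<Longrightarrow> (x has_vector_derivative x' s) (at s)"
  by (simp add: accessible_arc_def)

lemma accessible_arc_tendsto:
  fixes n :: "'a::real_normed_vector"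
  assumes "accessible_arc \<Omega> t d n x x'" "s \<in> ball t d"
  shows "((\<lambda>e. x s + e *\<^sub>R n) \<longlongrightarrow> x s) (at_right 0)" "\<forall>\<^sub>F e in at_right 0. x s + e *\<^sub>R n \<in> \<Omega>"
proof -
  have "((\<lambda>e. x s + e *\<^sub>R n) \<longlongrightarrow> x s + 0 *\<^sub>R n) (at_right 0)"
    by (intro tendsto_intros)
  then show "((\<lambda>e. x s + e *\<^sub>R n) \<longlongrightarrow> x s) (at_right 0)" by simp
  show "\<forall>\<^sub>F e in at_right 0. x s + e *\<^sub>R n \<in> \<Omega>"
    using assms by (auto simp: accessible_arc_def eventually_at_right_field)
qed

lemma accessible_arc_closure:
  assumes "accessible_arc \<Omega> t d n x x'" "s \<in> ball t d"
  shows "x s \<in> closure \<Omega>"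
  by (rule Lim_in_closed_set[OF closed_closure _ _ accessible_arc_tendsto(1)[OF assms]])
     (auto intro: eventually_mono[OF accessible_arc_tendsto(2)[OF assms]] closure_subset[THEN subsetD])

lemma dist_Pair_le: "dist (a, b) (c, d) \<le> dist a c + dist b d"
  by (simp add: dist_prod_def sqrt_sum_squares_le_sum)

text \<open>This is the mean value inequality for \<open>g s - s *\<^sub>R v\<close>, whose
  derivative \<open>g' s - v\<close> is bounded by \<open>e\<close>.\<close>

lemma linear_approximation_on_ball:
  fixes g g' :: "real \<Rightarrow> 'b::real_normed_vector"
  assumes "\<And>s. s \<in> ball t d \<Longrightarrow> (g has_vector_derivative g' s) (at s)"
    and "\<And>s. s \<in> ball t d \<Longrightarrow> norm (g' s - v) \<le> e" and "s \<in> ball t d" "0 < d"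
  shows "norm (g s - g t - (s - t) *\<^sub>R v) \<le> e * \<bar>s - t\<bar>"
proof -
  have "norm ((g s - s *\<^sub>R v) - (g t - t *\<^sub>R v)) \<le> e * norm (s - t)"
  proof (rule differentiable_bound[of "ball t d" "\<lambda>s. g s - s *\<^sub>R v" "\<lambda>s h. h *\<^sub>R (g' s - v)"])
    fix u assume u: "u \<in> ball t d"
    have "((\<lambda>s. g s - s *\<^sub>R v) has_vector_derivative g' u - v) (at u)"
      by (rule derivative_eq_intros assms(1)[OF u] refl | simp)+
    then show "((\<lambda>s. g s - s *\<^sub>R v) has_derivative (\<lambda>h. h *\<^sub>R (g' u - v))) (at u within ball t d)"
      by (simp add: has_vector_derivative_def has_derivative_at_withinI)
    show "onorm (\<lambda>h. h *\<^sub>R (g' u - v)) \<le> e"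
      by (rule onorm_le) (use assms(2)[OF u] in \<open>simp add: mult.commute[of e] mult_left_mono\<close>)
  qed (use assms in auto)
  then show ?thesis by (simp add: algebra_simps)
qed

text \<open>
  At a boundary point, \<open>F\<close> is not differentiable in the usual sense. The mean value inequality is
  applied to \<open>F\<close> along the translated arcs \<open>x + e n\<close> inside \<open>\<Omega>\<close>, and then \<open>e\<close> tends to \<open>0\<close>.
\<close>

lemma boundary_chain_rule:
  fixes F :: "'a::real_normed_vector \<Rightarrow> 'b::real_normed_vector" and L :: "'a \<Rightarrow> 'a \<Rightarrow>\<^sub>L 'b"
  assumes arc: "accessible_arc \<Omega> t d n x x'"
    and F: "continuous_on (closure \<Omega>) F" and L: "continuous_on (closure \<Omega>) L"
    and deriv: "\<And>z. z \<in> \<Omega> \<Longrightarrow> (F has_derivative blinfun_apply (L z)) (at z)"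
    and t0: "t0 \<in> ball t d"
  shows "((\<lambda>s. F (x s)) has_vector_derivative L (x t0) (x' t0)) (at t0)"
  unfolding has_vector_derivative_def has_derivative_at_alt
proof (intro conjI allI impI)
  define v where "v = L (x t0) (x' t0)"
  fix e :: real assume e: "0 < e"
  \<comment> \<open>Joint continuity in base point and direction controls the changes of
    \<open>L (x s)\<close> and of \<open>x' s\<close> together.\<close>
  have "continuous_on (closure \<Omega> \<times> UNIV) (\<lambda>p. blinfun_apply (L (fst p)) (snd p))"
    by (intro continuous_intros continuous_on_compose2[OF L]) auto
  moreover have "(x t0, x' t0) \<in> closure \<Omega> \<times> UNIV"
    using accessible_arc_closure[OF arc t0] by simp
  ultimately obtain r where r: "0 < r"
    "\<And>p. p \<in> closure \<Omega> \<times> UNIV \<Longrightarrow> dist p (x t0, x' t0) < r \<Longrightarrow>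
        dist (blinfun_apply (L (fst p)) (snd p)) v < e"
    using e unfolding continuous_on_iff v_def by (metis fst_conv snd_conv)
  \<comment> \<open>The radius \<open>r\<close> is split into thirds: motion along the arc, change
    of velocity, and the push \<open>h *\<^sub>R n\<close>.\<close>
  have near_x: "\<forall>\<^sub>F s in nhds t0. dist (x s) (x t0) < r / 3"
    using accessible_arc_vector_derivative[OF arc t0] r(1)
    by (intro tendstoD) (auto dest!: has_vector_derivative_continuous
        simp: continuous_at isCont_def tendsto_at_iff_tendsto_nhds)
  have "isCont x' t0"
    using arc t0 by (simp add: accessible_arc_def continuous_on_eq_continuous_at)
  then have near_x': "\<forall>\<^sub>F s in nhds t0. dist (x' s) (x' t0) < r / 3"
    using r(1) by (intro tendstoD) (auto simp: isCont_def tendsto_at_iff_tendsto_nhds)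
  have "\<forall>\<^sub>F s in nhds t0. s \<in> ball t d"
    using t0 by (intro eventually_nhds_in_open) auto
  with near_x near_x' obtain d0 where d0: "0 < d0" "\<And>s. s \<in> ball t0 d0 \<Longrightarrow>
      s \<in> ball t d \<and> dist (x s) (x t0) < r / 3 \<and> dist (x' s) (x' t0) < r / 3"
    unfolding eventually_nhds_metric by (smt (verit) dist_commute mem_ball)
  \<comment> \<open>\<open>d0\<close> is independent of \<open>h\<close>, so this bound is uniform
    in the push and survives the limit \<open>h\<close> to 0.\<close>
  have est: "norm (F (x s + h *\<^sub>R n) - F (x t0 + h *\<^sub>R n) - (s - t0) *\<^sub>R v) \<le> e * \<bar>s - t0\<bar>"
    if s: "s \<in> ball t0 d0" and h: "0 < h" "h < d" "h * norm n < r / 3" for s h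
  proof (rule linear_approximation_on_ball[OF _ _ s d0(1)])
    fix u assume "u \<in> ball t0 d0"
    note u = d0(2)[OF this]
    have \<Omega>: "x u + h *\<^sub>R n \<in> \<Omega>" using arc u h by (auto simp: accessible_arc_def)
    have "((\<lambda>s. x s + h *\<^sub>R n) has_vector_derivative x' u) (at u)"
      using accessible_arc_vector_derivative[OF arc] u by (auto intro!: derivative_eq_intros)
    from vector_derivative_diff_chain_within[OF this has_derivative_at_withinI[OF deriv[OF \<Omega>]]]
    show "((\<lambda>s. F (x s + h *\<^sub>R n)) has_vector_derivative L (x u + h *\<^sub>R n) (x' u)) (at u)"
      by (simp add: o_def)
    have "dist (x u + h *\<^sub>R n) (x t0) \<le> dist (x u) (x t0) + h * norm n"
      using h by (simp add: dist_norm) (smt (verit) norm_triangle_ineq norm_scaleR add_diff_eq add.commute add_diff_cancel_left' diff_add_eq)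
    moreover have "dist (x u + h *\<^sub>R n, x' u) (x t0, x' t0) \<le>
        dist (x u + h *\<^sub>R n) (x t0) + dist (x' u) (x' t0)"
      by (rule dist_Pair_le)
    ultimately have "dist (x u + h *\<^sub>R n, x' u) (x t0, x' t0) < r" using u h by linarith
    from r(2)[OF _ this] \<Omega> closure_subset[THEN subsetD, OF \<Omega>]
    show "norm (L (x u + h *\<^sub>R n) (x' u) - v) \<le> e" by (simp add: dist_norm less_imp_le)
  qed
  have lim: "((\<lambda>h. F (x s + h *\<^sub>R n)) \<longlongrightarrow> F (x s)) (at_right 0)" if "s \<in> ball t d" for s
    by (rule continuous_on_tendsto_compose[OF F accessible_arc_tendsto(1)[OF arc that]])
       (auto intro: accessible_arc_closure[OF arc that] closure_subset[THEN subsetD]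
         eventually_mono[OF accessible_arc_tendsto(2)[OF arc that]])
  have small: "\<forall>\<^sub>F h in at_right 0. 0 < h \<and> h < d \<and> h * norm n < r / 3"
  proof (intro eventually_conj)
    have "((\<lambda>h. h * norm n) \<longlongrightarrow> 0 * norm n) (at_right 0)" by (intro tendsto_intros)
    then show "\<forall>\<^sub>F h in at_right 0. h * norm n < r / 3"
      using r(1) by (intro order_tendstoD) auto
    show "\<forall>\<^sub>F h in at_right 0. h < d"
      using arc by (auto simp: accessible_arc_def eventually_at_right_field)
  qed (simp add: eventually_at_right_less)
  have "norm (F (x s) - F (x t0) - (s - t0) *\<^sub>R v) \<le> e * norm (s - t0)"
    if s: "norm (s - t0) < d0" for s
  proof -
    have s': "s \<in> ball t0 d0" using s by (simp add: dist_norm norm_minus_commute)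
    show ?thesis
    proof (rule tendsto_upperbound)
      show "((\<lambda>h. norm (F (x s + h *\<^sub>R n) - F (x t0 + h *\<^sub>R n) - (s - t0) *\<^sub>R v)) \<longlongrightarrow>
          norm (F (x s) - F (x t0) - (s - t0) *\<^sub>R v)) (at_right 0)"
        using d0(2)[OF s'] t0 by (intro tendsto_intros lim) auto
      show "\<forall>\<^sub>F h in at_right 0. norm (F (x s + h *\<^sub>R n) - F (x t0 + h *\<^sub>R n) - (s - t0) *\<^sub>R v)
          \<le> e * norm (s - t0)"
        using small by eventually_elim (use est[OF s'] in auto)
    qed simp
  qed
  then show "\<exists>d>0. \<forall>s. norm (s - t0) < d \<longrightarrow>
      norm (F (x s) - F (x t0) - (s - t0) *\<^sub>R L (x t0) (x' t0)) \<le> e * norm (s - t0)"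
    using d0(1) unfolding v_def by blast
qed (rule bounded_linear_scaleR_left)

section \<open>Rotated coordinates and arcs of the sonic curve\<close>

lemma rot_uminus_cancel [simp]: "rot \<theta> (rot (- \<theta>) z) = z" "rot (- \<theta>) (rot \<theta> z) = z"
proof -
  \<comment> \<open>Sine and cosine become free variables subject to
    \<open>s * s + c * c = 1\<close>, which leaves polynomial identities.\<close>
  have "c * (c * a - s * b) + s * (s * a + c * b) = a"
    "- s * (c * a - s * b) + c * (s * a + c * b) = b"
    "c * (c * a + s * b) - s * (- s * a + c * b) = a"
    "s * (c * a + s * b) + c * (- s * a + c * b) = b"
    if "s * s + c * c = 1" for a b c s :: real
    using that by algebra+
  from this[of "sin \<theta>" "cos \<theta>"]
  show "rot \<theta> (rot (- \<theta>) z) = z" "rot (- \<theta>) (rot \<theta> z) = z"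
    by (simp_all add: rot_def prod_eq_iff flip: power2_eq_square)
qed

lemma bounded_linear_rot [bounded_linear]: "bounded_linear (rot \<theta>)"
  unfolding rot_def
  by (intro bounded_linear_Pair bounded_linear_add bounded_linear_const_mult
      bounded_linear_fst bounded_linear_snd)

lemma rot_inner_rot [simp]: "rot \<theta> y \<bullet> rot \<theta> z = y \<bullet> z"
proof -
  have "(c * a + s * b) * (c * a' + s * b') + (- s * a + c * b) * (- s * a' + c * b') = a * a' + b * b'"
    if "s * s + c * c = 1" for a b a' b' c s :: real
    using that by algebra
  from this[of "sin \<theta>" "cos \<theta>"] show ?thesis
    by (simp add: rot_def inner_prod_def flip: power2_eq_square)
qed

lemma C11_on_deriv:
  assumes "C11_on l1 l2 f" "s \<in> {l1<..<l2}"
  shows "(f has_real_derivative deriv f s) (at s)"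
proof -
  have "f differentiable (at s)"
    using assms by (auto simp: C11_on_def differentiable_on_def at_within_open[OF _ open_greaterThanLessThan])
  then show ?thesis
    by (metis DERIV_imp_deriv real_differentiableE)
qed

lemma C11_on_continuous_deriv: "C11_on l1 l2 f \<Longrightarrow> continuous_on {l1<..<l2} (deriv f)"
  by (auto simp: C11_on_def intro: lipschitz_on_continuous_on)

lemma graph_at_iff:
  "graph_at \<Gamma> Q \<theta> r l1 l2 f \<Longrightarrow> z \<in> ball Q r \<Longrightarrow>
    z \<in> \<Gamma> \<longleftrightarrow> snd (rot \<theta> z) = f (fst (rot \<theta> z))"
  unfolding graph_at_def by blast

text \<open>
  The graph representing \<open>\<Gamma>\<close> in the definition of an exceptional point need not be the one used to
  parametrize \<open>\<Gamma>\<close>, but both have the same tangent.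
\<close>

lemma exceptional_orthogonal:
  assumes exc: "exceptional \<Gamma> G (x t)" and x: "(x has_vector_derivative v) (at t)"
    and \<Gamma>: "\<forall>\<^sub>F s in nhds t. x s \<in> \<Gamma>"
  shows "G (x t) \<bullet> v = 0"
proof -
  from exc obtain \<theta> r l1 l2 f where gr: "graph_at \<Gamma> (x t) \<theta> r l1 l2 f"
    and eq: "fst (rot \<theta> (G (x t))) + deriv f (fst (rot \<theta> (x t))) * snd (rot \<theta> (G (x t))) = 0"
    by (auto simp: exceptional_def)
  define a b where "a s = fst (rot \<theta> (x s))" and "b s = snd (rot \<theta> (x s))" for s
  have a: "(a has_vector_derivative fst (rot \<theta> v)) (at t)"
    and b: "(b has_vector_derivative snd (rot \<theta> v)) (at t)"
    unfolding a_def b_def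
    by (intro bounded_linear.has_vector_derivative[OF bounded_linear_compose[OF bounded_linear_fst bounded_linear_rot]]
        bounded_linear.has_vector_derivative[OF bounded_linear_compose[OF bounded_linear_snd bounded_linear_rot]] x)+
  have "\<forall>\<^sub>F s in nhds t. x s \<in> ball (x t) r"
    using has_vector_derivative_continuous[OF x] gr
    by (intro topological_tendstoD[of x "x t"])
       (auto simp: graph_at_def continuous_at isCont_def tendsto_at_iff_tendsto_nhds)
  \<comment> \<open>The curve satisfies the graph equation near \<open>t\<close>; differentiating it
    ties the two components of the rotated velocity by the slope of \<open>f\<close>.\<close>
  with \<Gamma> have "\<forall>\<^sub>F s in nhds t. f (a s) = b s"
    by eventually_elim (simp add: a_def b_def graph_at_iff[OF gr])
  moreover have "a t \<in> {l1<..<l2}" using gr by (auto simp: graph_at_def a_def)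
  then have "(f has_real_derivative deriv f (a t)) (at (a t))"
    using gr by (auto simp: graph_at_def intro: C11_on_deriv)
  then have "((\<lambda>s. f (a s)) has_vector_derivative fst (rot \<theta> v) * deriv f (a t)) (at t)"
    using field_vector_diff_chain_at[OF a] by (simp add: o_def)
  ultimately have "(b has_vector_derivative fst (rot \<theta> v) * deriv f (a t)) (at t)"
    unfolding has_vector_derivative_def
    by (force intro: has_derivative_transform_eventually dest: eventually_nhds_x_imp_x
        simp: eventually_at_filter elim: eventually_mono)
  then have "snd (rot \<theta> v) = fst (rot \<theta> v) * deriv f (a t)"
    using b by (simp add: vector_derivative_unique_at)
  \<comment> \<open>With \<open>v\<close> proportional to (1, f') in rotated coordinates, the inner
    product contains the exceptionality expression as a factor.\<close>
  then have "rot \<theta> (G (x t)) \<bullet> rot \<theta> v = fst (rot \<theta> v) *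
      (fst (rot \<theta> (G (x t))) + deriv f (a t) * snd (rot \<theta> (G (x t))))"
    by (simp add: inner_prod_def algebra_simps)
  then show ?thesis using eq by (simp add: a_def)
qed

text \<open>The arc is the graph, parametrized by the first rotated coordinate. Pushing it downwards
  enters \<open>\<Omega>\<close>, which is locally the region below the graph. The set
  \<open>U\<close> records that the arc covers a whole neighbourhood of \<open>Q\<close> in
  \<open>\<Gamma>\<close>, as local constancy will require.\<close>

lemma graph_accessible_arc:
  assumes gr: "graph_at \<Gamma> Q \<theta> r l1 l2 f" and Q: "Q \<in> \<Gamma>"
    and below: "\<Omega> \<inter> ball Q r = {x. snd (rot \<theta> x) < f (fst (rot \<theta> x))} \<inter> ball Q r"
  obtains t d n x x' U where "accessible_arc \<Omega> t d n x x'" "x ` ball t d \<subseteq> \<Gamma>"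
    "open U" "Q \<in> U" "\<Gamma> \<inter> U \<subseteq> x ` ball t d"
proof -
  define t where "t = fst (rot \<theta> Q)"
  \<comment> \<open>The downward unit vector of the rotated frame, in original coordinates.\<close>
  define n where "n = rot (- \<theta>) (0, -1)"
  define x where "x s = rot (- \<theta>) (s, f s)" for s
  define x' where "x' s = rot (- \<theta>) (1, deriv f s)" for s
  have r: "0 < r" and C: "C11_on l1 l2 f" using gr by (auto simp: graph_at_def)
  have t: "t \<in> {l1<..<l2}" using gr by (auto simp: graph_at_def t_def)
  have xt: "x t = Q"
  proof -
    have "snd (rot \<theta> Q) = f t" using graph_at_iff[OF gr, of Q] Q r by (simp add: t_def)
    then have "(t, f t) = rot \<theta> Q" by (simp add: t_def prod_eq_iff)
    then show ?thesis by (simp add: x_def)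
  qed
  have dx: "(x has_vector_derivative x' s) (at s)" if "s \<in> {l1<..<l2}" for s
    unfolding x_def x'_def
    by (intro bounded_linear.has_vector_derivative[OF bounded_linear_rot] has_vector_derivative_Pair
        has_vector_derivative_id C11_on_deriv[OF C that, unfolded has_real_derivative_iff_has_vector_derivative])
  \<comment> \<open>The limit is taken jointly in parameter and push, so that one radius serves
    both.\<close>
  have cont: "((\<lambda>p. x (fst p) + snd p *\<^sub>R n) \<longlongrightarrow> x t + 0 *\<^sub>R n) (nhds (t, 0))"
  proof (intro tendsto_intros)
    have "isCont x t" by (rule has_vector_derivative_continuous[OF dx[OF t]])
    then show "((\<lambda>p. x (fst p)) \<longlongrightarrow> x t) (nhds (t, 0))"
      by (intro isCont_tendsto_compose[of t x])  (auto intro: tendsto_eq_intros filterlim_ident)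
  qed (auto intro!: tendsto_eq_intros filterlim_ident)
  have "\<forall>\<^sub>F p in nhds (t, 0). x (fst p) + snd p *\<^sub>R n \<in> ball Q r"
    using r xt by (intro topological_tendstoD[OF cont]) auto
  moreover have "\<forall>\<^sub>F p in nhds (t, 0::real). fst p \<in> {l1<..<l2}"
    by (intro topological_tendstoD[OF tendsto_fst[of "\<lambda>p. p"]]) (use t in \<open>auto intro: filterlim_ident\<close>)
  ultimately obtain d0 where d0: "0 < d0"
    "\<And>s e. dist (s, e) (t, 0) < d0 \<Longrightarrow> x s + e *\<^sub>R n \<in> ball Q r \<and> s \<in> {l1<..<l2}"
    unfolding eventually_nhds_metric
    by (smt (verit, ccfv_threshold) eventually_conj eventually_nhds_metric fst_conv snd_conv)
  \<comment> \<open>Parameter offset and push each get half of \<open>d0\<close>, since the distance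
    of pairs is at most the sum of both.\<close>
  define d where "d = d0 / 2"
  have d: "0 < d" using d0 by (simp add: d_def)
  have near: "x s + e *\<^sub>R n \<in> ball Q r" "s \<in> {l1<..<l2}"
    if "s \<in> ball t d" "0 \<le> e" "e < d" for s e
  proof -
    have "dist (s, e) (t, 0) \<le> dist s t + dist e 0"
      by (rule dist_Pair_le)
    also have "\<dots> < d0" using that by (simp add: d_def dist_commute)
    finally show "x s + e *\<^sub>R n \<in> ball Q r" "s \<in> {l1<..<l2}" using d0(2) by blast+
  qed
  have near0: "x s \<in> ball Q r" "s \<in> {l1<..<l2}" if "s \<in> ball t d" for s
    using near[OF that, of 0] d by auto
  have rot_x: "rot \<theta> (x s + e *\<^sub>R n) = (s, f s - e)" for s e
    by (simp add: x_def n_def linear_add linear_scale bounded_linear.linear[OF bounded_linear_rot])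
  \<comment> \<open>The second factor keeps the parameter of each point of
    \<open>\<Gamma> \<inter> U\<close> within the range of the arc.\<close>
  define U where "U = ball Q r \<inter> (\<lambda>z. fst (rot \<theta> z)) -` ball t d"
  show thesis
  proof
    show "accessible_arc \<Omega> t d n x x'"
      unfolding accessible_arc_def
    proof (intro conjI ballI allI impI d)
      have "continuous_on (ball t d) (deriv f)"
        by (rule continuous_on_subset[OF C11_on_continuous_deriv[OF C]]) (use near0 in auto)
      then show "continuous_on (ball t d) x'"
        unfolding x'_def by (intro bounded_linear.continuous_on[OF bounded_linear_rot] continuous_intros)
    next
      fix s e assume s: "s \<in> ball t d" and e: "0 < e \<and> e < d"
      show "x s + e *\<^sub>R n \<in> \<Omega>"
        using below near(1)[OF s, of e] rot_x[of s e] e by fastforce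
    qed (use dx near0 in auto)
    show "x ` ball t d \<subseteq> \<Gamma>"
    proof
      fix z assume "z \<in> x ` ball t d"
      then obtain s where s: "s \<in> ball t d" "z = x s" by auto
      then show "z \<in> \<Gamma>"
        using graph_at_iff[OF gr near0(1)[OF s(1)]] rot_x[of s 0] by simp
    qed
    have "continuous_on UNIV (\<lambda>z. fst (rot \<theta> z))"
      by (intro continuous_intros bounded_linear.continuous_on[OF bounded_linear_rot])
    then show "open U"
      unfolding U_def by (intro open_Int open_ball open_vimage) 
    show "Q \<in> U" using r d by (simp add: U_def t_def)
    show "\<Gamma> \<inter> U \<subseteq> x ` ball t d"
    proof
      fix z assume z: "z \<in> \<Gamma> \<inter> U"
      then have "snd (rot \<theta> z) = f (fst (rot \<theta> z))"
        using graph_at_iff[OF gr, of z] by (simp add: U_def)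
      then have "(fst (rot \<theta> z), f (fst (rot \<theta> z))) = rot \<theta> z" by (simp add: prod_eq_iff)
      then have "x (fst (rot \<theta> z)) = z" by (simp add: x_def)
      then show "z \<in> x ` ball t d" using z by (force simp: U_def)
    qed
  qed
qed

section \<open>The flow equation up to the sonic curve\<close>

text \<open>Where the density is positive, the product rule turns the divergence form into the
  nondivergence form times the positive factor \<open>p * P\<close>, which cancels.\<close>

lemma potential_flow_nondivergence:
  fixes H :: "plane \<Rightarrow>\<^sub>L plane"
  assumes flow: "potential_flow \<gamma> K \<Omega> \<phi> G" and z: "z \<in> \<Omega>"
    and \<phi>: "(\<phi> has_derivative (\<lambda>h. G z \<bullet> h)) (at z)"
    and G: "(G has_derivative blinfun_apply H) (at z)"
    and B: "0 < bernoulli K \<phi> G z" and \<gamma>: "1 < \<gamma>"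
  shows "(\<gamma> - 1) * bernoulli K \<phi> G z * (fst (H (1, 0)) + snd (H (0, 1)) + 2) =
    G z \<bullet> G z + G z \<bullet> H (G z)"
proof -
  define p where "p = 1 / (\<gamma> - 1)"
  \<comment> \<open>With B for \<open>bernoulli\<close>, the density is \<open>P\<close> times B and
    its gradient is \<open>p * P\<close> times that of B.\<close>
  define P where "P = bernoulli K \<phi> G z powr (p - 1)"
  obtain \<xi> \<eta> where z_eq: "z = (\<xi>, \<eta>)" by (cases z)
  have bern: "(bernoulli K \<phi> G has_derivative (\<lambda>h. - (G z \<bullet> h) - G z \<bullet> H h)) (at z)"
    unfolding bernoulli_def power2_norm_eq_inner
    by (rule derivative_eq_intros \<phi> G refl | simp add: inner_commute)+
  have dens: "(density \<gamma> K \<phi> G has_derivative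
      (\<lambda>h. p * P * (- (G z \<bullet> h) - G z \<bullet> H h))) (at z)"
    unfolding density_def P_def p_def
    by (rule has_derivative_eq_rhs, rule has_derivative_powr[OF bern has_derivative_const B])
       (use B in \<open>auto simp: fun_eq_iff powr_diff field_simps\<close>)
  have dens_z: "density \<gamma> K \<phi> G z = P * bernoulli K \<phi> G z"
    using B by (simp add: density_def P_def p_def powr_diff)
  \<comment> \<open>The solution concept supplies only derivatives along coordinate lines; composing
    with these lines identifies \<open>a\<close> and \<open>b\<close> by uniqueness of
    derivatives.\<close>
  have line1: "((\<lambda>s. (s, \<eta>)) has_derivative (\<lambda>h. (h, 0))) (at \<xi>)"
    and line2: "((\<lambda>t. (\<xi>, t)) has_derivative (\<lambda>h. (0, h))) (at \<eta>)"
    by (auto intro!: derivative_eq_intros)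
  define H1 H2 where "H1 = H (1, 0)" and "H2 = H (0, 1)"
  have smul: "H (h, 0) = h *\<^sub>R H1" "H (0, h) = h *\<^sub>R H2" for h
    by (simp_all add: H1_def H2_def flip: blinfun.scaleR_right)
  from flow z obtain a b where
    a: "((\<lambda>s. density \<gamma> K \<phi> G (s, \<eta>) * fst (G (s, \<eta>))) has_real_derivative a) (at \<xi>)" and
    b: "((\<lambda>t. density \<gamma> K \<phi> G (\<xi>, t) * snd (G (\<xi>, t))) has_real_derivative b) (at \<eta>)" and
    ab: "a + b + 2 * density \<gamma> K \<phi> G z = 0"
    unfolding potential_flow_def z_eq by fast
  have "((\<lambda>z. density \<gamma> K \<phi> G z * fst (G z)) has_derivative
      (\<lambda>h. p * P * (- (G z \<bullet> h) - G z \<bullet> H h) * fst (G z) + P * bernoulli K \<phi> G z * fst (H h))) (at z)"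
    by (rule derivative_eq_intros dens G refl | simp add: dens_z add.commute)+
  from has_derivative_compose[OF line1 this[unfolded z_eq]]
  have a_eq: "a = p * P * (- fst (G z) - G z \<bullet> H1) * fst (G z) + P * bernoulli K \<phi> G z * fst H1"
    by (intro DERIV_unique[OF a] has_derivative_imp_has_field_derivative)
       (auto simp: z_eq smul(1) inner_prod_def algebra_simps)
  have "((\<lambda>z. density \<gamma> K \<phi> G z * snd (G z)) has_derivative
      (\<lambda>h. p * P * (- (G z \<bullet> h) - G z \<bullet> H h) * snd (G z) + P * bernoulli K \<phi> G z * snd (H h))) (at z)"
    by (rule derivative_eq_intros dens G refl | simp add: dens_z add.commute)+
  from has_derivative_compose[OF line2 this[unfolded z_eq]]
  have b_eq: "b = p * P * (- snd (G z) - G z \<bullet> H2) * snd (G z) + P * bernoulli K \<phi> G z * snd H2"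
    by (intro DERIV_unique[OF b] has_derivative_imp_has_field_derivative)
       (auto simp: z_eq smul(2) inner_prod_def algebra_simps)
  have HG: "H (G z) = fst (G z) *\<^sub>R H1 + snd (G z) *\<^sub>R H2"
    by (simp add: H1_def H2_def flip: blinfun.scaleR_right blinfun.add_right)
  \<comment> \<open>\<open>W\<close> is the defect of the claimed identity;
    \<open>p * (\<gamma> - 1) = 1\<close> makes the flow equation read
    \<open>p * P * W = 0\<close>.\<close>
  define W where "W = (\<gamma> - 1) * bernoulli K \<phi> G z * (fst (H1) + snd (H2) + 2) -
    (G z \<bullet> G z + G z \<bullet> H (G z))"
  have "a + b + 2 * density \<gamma> K \<phi> G z = p * P * W"
  proof -
    have "p * (\<gamma> - 1) = 1" using \<gamma> by (simp add: p_def)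
    then show ?thesis
      unfolding a_eq b_eq dens_z W_def HG inner_prod_def fst_add snd_add fst_scaleR snd_scaleR
        inner_real_def real_scaleR_def
      by algebra
  qed
  moreover have "0 < p * P" using B \<gamma> by (simp add: P_def p_def)
  ultimately have "W = 0" using ab by auto
  then show ?thesis by (simp add: W_def H1_def H2_def)
qed

text \<open>The factor \<open>bernoulli\<close> makes the equation hold at all points of \<open>\<Omega>\<close>, vacuum included.\<close>

lemma potential_flow_nondivergence_closure:
  fixes H :: "plane \<Rightarrow> (plane \<Rightarrow>\<^sub>L plane)"
  assumes flow: "potential_flow \<gamma> K \<Omega> \<phi> G" and \<gamma>: "1 < \<gamma>"
    and cont: "continuous_on (closure \<Omega>) \<phi>" "continuous_on (closure \<Omega>) G" "continuous_on (closure \<Omega>) H"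
    and deriv: "\<And>z. z \<in> \<Omega> \<Longrightarrow> (\<phi> has_derivative (\<lambda>h. G z \<bullet> h)) (at z)"
      "\<And>z. z \<in> \<Omega> \<Longrightarrow> (G has_derivative blinfun_apply (H z)) (at z)"
    and Q: "Q \<in> closure \<Omega>" "0 < bernoulli K \<phi> G Q"
  shows "(\<gamma> - 1) * bernoulli K \<phi> G Q * (fst (H Q (1, 0)) + snd (H Q (0, 1)) + 2) =
    G Q \<bullet> G Q + G Q \<bullet> H Q (G Q)"
proof -
  let ?q = "\<lambda>z. bernoulli K \<phi> G z * ((\<gamma> - 1) * bernoulli K \<phi> G z * (fst (H z (1, 0)) + snd (H z (0, 1)) + 2) -
    (G z \<bullet> G z + G z \<bullet> H z (G z)))"
  have "?q Q = 0"
  proof (rule continuous_constant_on_closure[OF _ _ Q(1)])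
    show "continuous_on (closure \<Omega>) ?q"
      unfolding bernoulli_def by (intro continuous_intros cont) auto
    fix z assume z: "z \<in> \<Omega>"
    with flow have "0 \<le> bernoulli K \<phi> G z" by (auto simp: potential_flow_def)
    then show "?q z = 0"
      using potential_flow_nondivergence[OF flow z deriv[OF z] _ \<gamma>] by (cases "bernoulli K \<phi> G z = 0") auto
  qed
  then show ?thesis using Q(2) by simp
qed

text \<open>
  At a sonic point, \<open>G \<bullet> G = c\<^sup>2\<close> and \<open>trace\<close> is the flow equation. Since \<open>T\<close> is orthogonal to \<open>G\<close>,
  it says that \<open>T \<bullet> (H T + T) = 0\<close>.
\<close>

lemma plane_trace_orthogonal_basis:
  fixes H :: "plane \<Rightarrow>\<^sub>L plane"
  assumes "G \<bullet> T = 0" "G \<noteq> 0"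
    and trace: "(G \<bullet> G) * (fst (H (1, 0)) + snd (H (0, 1)) + 2) = G \<bullet> G + G \<bullet> H G"
    and tangential: "G \<bullet> H T = 0"
  shows "H T = - T"
proof -
  obtain U V a b where G: "G = (U, V)" and T: "T = (a, b)" by (cases G, cases T)
  obtain h11 h21 h12 h22 where h: "H (1, 0) = (h11, h21)" "H (0, 1) = (h12, h22)" by fastforce
  have H: "H (x, y) = (h11 * x + h12 * y, h21 * x + h22 * y)" for x y
  proof -
    have "H (x, y) = H (x *\<^sub>R (1, 0) + y *\<^sub>R (0, 1))" by simp
    also have "\<dots> = x *\<^sub>R (h11, h21) + y *\<^sub>R (h12, h22)"
      unfolding blinfun.add_right blinfun.scaleR_right h ..
    finally show ?thesis by (simp add: mult.commute)
  qed
  have N: "U\<^sup>2 + V\<^sup>2 > 0" using assms(2) by (simp add: G sum_power2_gt_zero_iff prod_eq_iff)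
  \<comment> \<open>\<open>T\<close> is orthogonal to \<open>(U, V)\<close>, hence equals
    \<open>k\<close> times \<open>(- V, U)\<close>.\<close>
  define k where "k = (U * b - V * a) / (U\<^sup>2 + V\<^sup>2)"
  have orth: "U * a + V * b = 0" using assms(1) by (simp add: G T)
  have k: "(U\<^sup>2 + V\<^sup>2) * k = U * b - V * a" using N by (simp add: k_def)
  have "(U\<^sup>2 + V\<^sup>2) * (a + k * V) = 0" "(U\<^sup>2 + V\<^sup>2) * (b - k * U) = 0"
    using orth k by algebra+
  then have ab: "a = - k * V" "b = k * U" using N by auto
  \<comment> \<open>In the orthogonal basis \<open>(U, V)\<close>, \<open>(- V, U)\<close>, the
    trace times \<open>U\<^sup>2 + V\<^sup>2\<close> is the sum of the two diagonal values of the
    quadratic form. So \<open>trace\<close> kills the tangential part of \<open>H T + T\<close>, and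
    \<open>tangential\<close> its normal part.\<close>
  have "(U\<^sup>2 + V\<^sup>2) * (h11 * a + h12 * b + a) = 0" "(U\<^sup>2 + V\<^sup>2) * (h21 * a + h22 * b + b) = 0"
    using trace tangential unfolding ab G T H h inner_prod_def inner_real_def fst_conv snd_conv
    by algebra+
  then show ?thesis using N by (auto simp: T H)
qed

section \<open>From vanishing tangential derivatives to constants on the curve\<close>

lemma accessible_arc_eventually:
  assumes "accessible_arc \<Omega> t d n x x'" "x ` ball t d \<subseteq> \<Gamma>" "s \<in> ball t d"
  shows "\<forall>\<^sub>F s in nhds s. x s \<in> \<Gamma>"
proof -
  have "\<forall>\<^sub>F s in nhds s. s \<in> ball t d"
    using assms by (intro eventually_nhds_in_open) auto
  then show ?thesis by eventually_elim (use assms in auto)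
qed

text \<open>\<open>F\<close> is constant on each arc, and each arc fills a relative neighbourhood,
  so \<open>F\<close> is locally constant on a connected set.\<close>

lemma constant_if_derivative_zero_along_arcs:
  fixes F :: "'a::real_normed_vector \<Rightarrow> 'b::real_normed_vector"
  assumes "connected \<Gamma>"
    and arcs: "\<And>Q. Q \<in> \<Gamma> \<Longrightarrow> \<exists>t d x U. x ` ball t d \<subseteq> \<Gamma> \<and> open U \<and> Q \<in> U \<and> \<Gamma> \<inter> U \<subseteq> x ` ball t d \<and>
      (\<forall>s\<in>ball t d. ((\<lambda>s. F (x s)) has_vector_derivative 0) (at s))"
  shows "\<exists>c. \<forall>Q\<in>\<Gamma>. F Q = c"
proof (cases "\<Gamma> = {}")
  case False
  then obtain Q0 where Q0: "Q0 \<in> \<Gamma>" by auto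
  have "F Q = F Q0" if "Q \<in> \<Gamma>" for Q
  proof (rule connected_local_const[OF assms(1) that Q0], intro ballI)
    fix P assume P: "P \<in> \<Gamma>"
    then obtain t d x U where arc: "x ` ball t d \<subseteq> \<Gamma>" "open U" "P \<in> U" "\<Gamma> \<inter> U \<subseteq> x ` ball t d"
      "\<And>s. s \<in> ball t d \<Longrightarrow> ((\<lambda>s. F (x s)) has_vector_derivative 0) (at s)"
      using arcs by meson
    obtain c where c: "\<And>s. s \<in> ball t d \<Longrightarrow> F (x s) = c"
      by (rule has_vector_derivative_zero_constant[of "ball t d" "\<lambda>s. F (x s)"])
         (use arc(5) in \<open>auto intro: has_vector_derivative_at_within\<close>)
    have "\<forall>z\<in>\<Gamma> \<inter> U. F z = c" using arc(4) c by blast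
    then have "\<forall>z\<in>\<Gamma> \<inter> U. F P = F z" using P arc(3) by auto
    then show "\<forall>\<^sub>F z in at P within \<Gamma>. F P = F z"
      using arc(2,3) unfolding eventually_at_topological by blast
  qed
  then show ?thesis by blast
qed simp

section \<open>Constant potential, sonic speed and velocity on the sonic curve\<close>

theorem mainTheorem2:
  fixes \<gamma> K :: real
    and D \<Omega>m \<Omega>p \<Gamma> :: "plane set"
    and \<phi>m \<phi>p :: "plane \<Rightarrow> real"
    and Gm Gp :: "plane \<Rightarrow> plane"
  assumes "\<gamma> > 1"
    and "sonic_configuration \<gamma> K D \<Omega>m \<Omega>p \<phi>m Gm \<phi>p Gp \<Gamma>"
    and "connected \<Gamma>"
    and "\<forall>Q\<in>\<Gamma>. exceptional \<Gamma> Gm Q"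
    and "\<forall>Q\<in>\<Gamma>. sonic_speed \<gamma> K \<phi>m Gm Q > 0"
  shows "\<exists>c2 u2 v2.
      (\<forall>Q\<in>\<Gamma>. sonic_speed \<gamma> K \<phi>m Gm Q = c2) \<and>
      (\<exists>a r. 0 < r \<and> \<Gamma> \<subseteq> sphere a r) \<and>
      (\<forall>(\<xi>, \<eta>)\<in>\<Gamma>. Gm (\<xi>, \<eta>) = (u2 - \<xi>, v2 - \<eta>))"
proof -
  interpret sonic_configuration \<gamma> K D \<Omega>m \<Omega>p \<phi>m Gm \<phi>p Gp \<Gamma> "{x \<in> D - \<Omega>p. sonic_at \<gamma> K \<phi>m Gm x}"
    by (fact assms(2))
  obtain H :: "plane \<Rightarrow> (plane \<Rightarrow>\<^sub>L plane)" where
    cont: "continuous_on (closure \<Omega>m) \<phi>m" "continuous_on (closure \<Omega>m) Gm" "continuous_on (closure \<Omega>m) H"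
    and deriv: "\<And>z. z \<in> \<Omega>m \<Longrightarrow> (\<phi>m has_derivative (\<lambda>h. Gm z \<bullet> h)) (at z)"
      "\<And>z. z \<in> \<Omega>m \<Longrightarrow> (Gm has_derivative blinfun_apply (H z)) (at z)"
    using C2_m unfolding C2_upto_def by auto
  have \<Gamma>_sub: "Q \<in> closure \<Omega>m" "norm (Gm Q) = sonic_speed \<gamma> K \<phi>m Gm Q"
    "0 < bernoulli K \<phi>m Gm Q" "Gm Q \<bullet> Gm Q = (\<gamma> - 1) * bernoulli K \<phi>m Gm Q"
    if "Q \<in> \<Gamma>" for Q
  proof -
    have "Q \<in> {x \<in> D - \<Omega>p. sonic_at \<gamma> K \<phi>m Gm x}"
      using that Gamma by (auto simp: curve_interior_def)
    then show "Q \<in> closure \<Omega>m" and eq: "norm (Gm Q) = sonic_speed \<gamma> K \<phi>m Gm Q"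
      using flow_region(2) by (auto simp: sonic_at_def)
    have pos: "0 < sonic_speed \<gamma> K \<phi>m Gm Q" using assms(5) that by blast
    \<comment> \<open>\<open>sqrt\<close> is negative on negative reals, so a positive root forces a
      positive argument.\<close>
    then show "0 < bernoulli K \<phi>m Gm Q"
      using assms(1) by (simp add: sonic_speed_def zero_less_mult_iff)
    then show "Gm Q \<bullet> Gm Q = (\<gamma> - 1) * bernoulli K \<phi>m Gm Q"
      using assms(1) eq by (simp add: sonic_speed_def flip: power2_norm_eq_inner)
  qed
  have arcs: "\<exists>t d n x x' U. accessible_arc \<Omega>m t d n x x' \<and> x ` ball t d \<subseteq> \<Gamma> \<and> open U \<and> Q \<in> U \<and>
      \<Gamma> \<inter> U \<subseteq> x ` ball t d" if "Q \<in> \<Gamma>" for Q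
  proof -
    from two_sided that obtain \<theta> r l1 l2 f where "graph_at \<Gamma> Q \<theta> r l1 l2 f"
      "\<Omega>m \<inter> ball Q r = {x. snd (rot \<theta> x) < f (fst (rot \<theta> x))} \<inter> ball Q r"
      by metis
    from graph_accessible_arc[OF this(1) that this(2)] show ?thesis by metis
  qed
  have orth: "Gm (x s) \<bullet> x' s = 0"
    if "accessible_arc \<Omega>m t d n x x'" "x ` ball t d \<subseteq> \<Gamma>" "s \<in> ball t d" for t d n x x' s
  proof -
    have "exceptional \<Gamma> Gm (x s)" using assms(4) that(2,3) by blast
    then show ?thesis
      by (rule exceptional_orthogonal[OF _ accessible_arc_vector_derivative[OF that(1,3)]
            accessible_arc_eventually[OF that]])
  qed
  have "\<exists>k. \<forall>Q\<in>\<Gamma>. \<phi>m Q = k"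
  proof (rule constant_if_derivative_zero_along_arcs[OF assms(3)])
    fix Q assume "Q \<in> \<Gamma>"
    from arcs[OF this] obtain t d n x x' U where arc: "accessible_arc \<Omega>m t d n x x'"
      "x ` ball t d \<subseteq> \<Gamma>" "open U" "Q \<in> U" "\<Gamma> \<inter> U \<subseteq> x ` ball t d" by blast
    \<comment> \<open>The boundary chain rule gives the derivative
      \<open>Gm (x s) \<bullet> x' s\<close>, which vanishes by exceptionality.\<close>
    have "((\<lambda>s. \<phi>m (x s)) has_vector_derivative 0) (at s)" if "s \<in> ball t d" for s
      using boundary_chain_rule[OF arc(1) cont(1), of "\<lambda>z. blinfun_inner_right (Gm z)" s]
        orth[OF arc(1,2) that] that deriv(1)
        bounded_linear.continuous_on[OF bounded_linear_blinfun_inner_right cont(2)]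
      by (simp add: blinfun_inner_right.rep_eq)
    with arc show "\<exists>t d x U. x ` ball t d \<subseteq> \<Gamma> \<and> open U \<and> Q \<in> U \<and> \<Gamma> \<inter> U \<subseteq> x ` ball t d \<and>
      (\<forall>s\<in>ball t d. ((\<lambda>s. \<phi>m (x s)) has_vector_derivative 0) (at s))" by blast
  qed
  then obtain k where k: "\<And>Q. Q \<in> \<Gamma> \<Longrightarrow> \<phi>m Q = k" by blast
  \<comment> \<open>Solution of \<open>m = (\<gamma> - 1) * (K - k - m / 2)\<close>, the Bernoulli
    law at a sonic point with potential \<open>k\<close>.\<close>
  define m where "m = 2 * (\<gamma> - 1) * (K - k) / (\<gamma> + 1)"
  have Gm2: "Gm Q \<bullet> Gm Q = m" if "Q \<in> \<Gamma>" for Q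
    using \<Gamma>_sub(4)[OF that] k[OF that] assms(1)
    unfolding bernoulli_def power2_norm_eq_inner m_def by (simp add: field_simps)
  have "\<exists>w. \<forall>Q\<in>\<Gamma>. Gm Q + Q = w"
  proof (rule constant_if_derivative_zero_along_arcs[OF assms(3)])
    fix Q assume "Q \<in> \<Gamma>"
    from arcs[OF this] obtain t d n x x' U where arc: "accessible_arc \<Omega>m t d n x x'"
      "x ` ball t d \<subseteq> \<Gamma>" "open U" "Q \<in> U" "\<Gamma> \<inter> U \<subseteq> x ` ball t d" by blast
    have "((\<lambda>s. Gm (x s) + x s) has_vector_derivative 0) (at s)" if s: "s \<in> ball t d" for s
    proof -
      have xs: "x s \<in> \<Gamma>" using arc(2) s by auto
      have dG: "((\<lambda>s. Gm (x s)) has_vector_derivative H (x s) (x' s)) (at s)"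
        by (rule boundary_chain_rule[OF arc(1) cont(2,3) deriv(2) s])
      \<comment> \<open>The squared pseudo-speed is differentiated by the chain rule and as the
        constant \<open>m\<close>; comparing the results gives \<open>tang\<close>.\<close>
      have "((\<lambda>s. Gm (x s) \<bullet> Gm (x s)) has_vector_derivative 2 * (Gm (x s) \<bullet> H (x s) (x' s))) (at s)"
        using dG unfolding has_vector_derivative_def
        by (auto intro!: derivative_eq_intros simp: fun_eq_iff inner_commute algebra_simps)
      moreover have "((\<lambda>s. Gm (x s) \<bullet> Gm (x s)) has_vector_derivative 0) (at s)"
      proof (rule has_vector_derivative_transform_within_open[of "\<lambda>_. m" _ _ "ball t d"])
        show "m = Gm (x u) \<bullet> Gm (x u)" if "u \<in> ball t d" for u
          using that arc(2) Gm2 by (metis image_subset_iff)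
      qed (use s in auto)
      ultimately have tang: "Gm (x s) \<bullet> H (x s) (x' s) = 0"
        using vector_derivative_unique_at by fastforce
      have "Gm (x s) \<noteq> 0" using \<Gamma>_sub(2)[OF xs] assms(5) xs by force
      \<comment> \<open>Sonicity replaces the squared sonic speed by
        \<open>Gm (x s) \<bullet> Gm (x s)\<close> in the flow equation.\<close>
      moreover have "Gm (x s) \<bullet> Gm (x s) * (fst (H (x s) (1, 0)) + snd (H (x s) (0, 1)) + 2) =
          Gm (x s) \<bullet> Gm (x s) + Gm (x s) \<bullet> H (x s) (Gm (x s))"
        using potential_flow_nondivergence_closure[OF solution_m assms(1) cont deriv \<Gamma>_sub(1,3)[OF xs]]
        by (simp add: \<Gamma>_sub(4)[OF xs])
      ultimately have "H (x s) (x' s) = - x' s"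
        using plane_trace_orthogonal_basis[OF orth[OF arc(1,2) s]] tang by blast
      then show ?thesis
        using has_vector_derivative_add[OF dG accessible_arc_vector_derivative[OF arc(1) s]] by simp
    qed
    with arc show "\<exists>t d x U. x ` ball t d \<subseteq> \<Gamma> \<and> open U \<and> Q \<in> U \<and> \<Gamma> \<inter> U \<subseteq> x ` ball t d \<and>
      (\<forall>s\<in>ball t d. ((\<lambda>s. Gm (x s) + x s) has_vector_derivative 0) (at s))" by blast
  qed
  then obtain w where w: "\<And>Q. Q \<in> \<Gamma> \<Longrightarrow> Gm Q + Q = w" by blast
  have speed: "sonic_speed \<gamma> K \<phi>m Gm Q = sqrt m" if "Q \<in> \<Gamma>" for Q
    using \<Gamma>_sub(2)[OF that] Gm2[OF that] by (simp add: norm_eq_sqrt_inner)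
  have Gm_eq: "Gm Q = w - Q" if "Q \<in> \<Gamma>" for Q
    using w[OF that] by (simp add: algebra_simps flip: w[OF that])
  have "\<exists>a r. 0 < r \<and> \<Gamma> \<subseteq> sphere a r"
  \<comment> \<open>For empty \<open>\<Gamma>\<close> the value \<open>m\<close> need not be
    positive, so an arbitrary circle is taken; otherwise a point of \<open>\<Gamma>\<close> gives
    \<open>0 < sqrt m\<close>.\<close>
  proof (cases "\<Gamma> = {}")
    case True
    then show ?thesis using zero_less_one by blast
  next
    case False
    have "\<Gamma> \<subseteq> sphere w (sqrt m)"
      using Gm_eq \<Gamma>_sub(2) speed by (auto simp: dist_norm)
    moreover have "0 < sqrt m" using False assms(5) speed by auto
    ultimately show ?thesis by blast
  qed
  moreover have "\<forall>(\<xi>, \<eta>)\<in>\<Gamma>. Gm (\<xi>, \<eta>) = (fst w - \<xi>, snd w - \<eta>)"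
    using Gm_eq by (auto simp: prod_eq_iff)
  ultimately show ?thesis using speed by blast
qed

end
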